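(* Let $N\ge1$, let $F,F_m^S,F_1^P,\dots,F_N^P$ be positive integers with $F_m^S\le F$ and $\sum_{n=1}^N F_n^P\le F$, and put $F_f=F-\sum_{n=1}^NF_n^P$. Let $C_m$ be the capacity with subcarrier collisions of the $m$th secondary user in the presence of $N$ primary users, as defined in the context. Then $$\mathbb{E}\left[C_m\right]=\frac{F_m^S}{F}\left[\sum_{n=1}^{N}F_n^P\,\mathbb{E}\left[C_{m,i}^{I,n}\right]+F_f\,\mathbb{E}\left[C_{m,i}^{NI}\right]\right].$$
   Context: Model. There are $F$ subcarriers; primary users (PUs) $n=1,\dots,N$ use pairwise disjoint fixed sets of $F_n^P$ subcarriers, and $F_f$ subcarriers are free. The secondary user (SU) picks a set of $F_m^S$ of the $F$ subcarriers uniformly at random (without replacement). Let $k_{nm}$ be the number of picked subcarriers used by PU $n$ and $k_{fm}=F_m^S-\sum_n k_{nm}$ the number of picked free subcarriers; $(k_{1m},\dots,k_{Nm},k_{fm})$ is multivariate hypergeometric. Per-subcarrier quantities: $P_{m,i},P_{n,i},\Psi_i,\eta>0$ are constants not depending on the subcarrier index $i$ (SU peak transmit power, transmit power of PU $n$, interference temperature, noise variance). $h_{m,i},h_{mp,i},g_{ns,i}$ are independent positive random variables (channel power gains, arbitrary fading distributions), i.i.d. over $i$. Set $\lambda_{m,i}=h_{m,i}\min\{P_{m,i},\Psi_i/h_{mp,i}\}$, $C_{m,i}^{I,n}=\log\bigl(1+\lambda_{m,i}/(P_{n,i}g_{ns,i}+\eta)\bigr)$ and $C_{m,i}^{NI}=\log(1+\lambda_{m,i}/\eta)$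 (natural logarithm), assumed to have finite mean. For each $n$ the variables $C_{m,i}^{I,n}$ are identically distributed in $i$, and so are $C_{m,i}^{NI}$; the random subcarrier choice is independent of the channel gains. The SU capacity with collisions is $$C_m=\sum_{n=1}^N\sum_{i=1}^{k_{nm}}C_{m,i}^{I,n}+\sum_{i=1}^{k_{fm}}C_{m,i}^{NI}.$$ *)

theory Defs
  imports "HOL-Probability.Probability"
begin

text \<open>
  Subcarriers are numbered \<open>1..F\<close> and primary users \<open>1..N\<close>. Primary user \<open>n\<close> occupies the
  set \<open>A n\<close> of subcarriers, and \<open>S \<omega>\<close> is the set of subcarriers picked by the secondary user.
\<close>

definition choices :: "nat \<Rightarrow> nat \<Rightarrow> nat set set" where
  "choices F FS = {T. T \<subseteq> {1..F} \<and> card T = FS}"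

definition uniform_choice :: "'a measure \<Rightarrow> nat \<Rightarrow> nat \<Rightarrow> ('a \<Rightarrow> nat set) \<Rightarrow> bool" where
  "uniform_choice M F FS S \<longleftrightarrow>
     S \<in> measurable M (count_space (choices F FS)) \<and>
     distr M (count_space (choices F FS)) S = uniform_count_measure (choices F FS)"

definition collisions :: "(nat \<Rightarrow> nat set) \<Rightarrow> ('a \<Rightarrow> nat set) \<Rightarrow> nat \<Rightarrow> 'a \<Rightarrow> nat" where
  "collisions A S n \<omega> = card (S \<omega> \<inter> A n)"

text \<open>
  The subtraction below does not truncate when the sets \<open>A n\<close> are disjoint and
  \<open>card (S \<omega>) = FS\<close>.
\<close>

definition free_picked ::
    "nat \<Rightarrow> nat \<Rightarrow> (nat \<Rightarrow> nat set) \<Rightarrow> ('a \<Rightarrow> nat set) \<Rightarrow> 'a \<Rightarrow> nat" where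
  "free_picked N FS A S \<omega> = FS - (\<Sum>n=1..N. collisions A S n \<omega>)"

text \<open>
  The index type makes the gains \<open>h i\<close> (secondary link), \<open>hp i\<close> (secondary transmitter to
  primary receiver) and \<open>g n i\<close> (primary user \<open>n\<close> to secondary receiver) a single family, so
  that their mutual independence can be stated with \<open>indep_vars\<close>.
\<close>

datatype gain_index = SecLink nat | SecToPrim nat | PrimToSec nat nat

primrec gain ::
    "(nat \<Rightarrow> 'a \<Rightarrow> real) \<Rightarrow> (nat \<Rightarrow> 'a \<Rightarrow> real) \<Rightarrow> (nat \<Rightarrow> nat \<Rightarrow> 'a \<Rightarrow> real) \<Rightarrow>
     gain_index \<Rightarrow> 'a \<Rightarrow> real" where
  "gain h hp g (SecLink i) = h i"
| "gain h hp g (SecToPrim i) = hp i"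
| "gain h hp g (PrimToSec n i) = g n i"

definition gain_indices :: "nat \<Rightarrow> nat \<Rightarrow> gain_index set" where
  "gain_indices N F =
     SecLink ` {1..F} \<union> SecToPrim ` {1..F} \<union> (\<Union>n\<in>{1..N}. PrimToSec n ` {1..F})"

definition gain_vector ::
    "nat \<Rightarrow> nat \<Rightarrow> (nat \<Rightarrow> 'a \<Rightarrow> real) \<Rightarrow> (nat \<Rightarrow> 'a \<Rightarrow> real) \<Rightarrow> (nat \<Rightarrow> nat \<Rightarrow> 'a \<Rightarrow> real) \<Rightarrow>
     'a \<Rightarrow> (gain_index \<Rightarrow> real)" where
  "gain_vector N F h hp g \<omega> = (\<lambda>j\<in>gain_indices N F. gain h hp g j \<omega>)"

text \<open>
  Independence of two random variables whose values have different types; \<open>indep_var\<close> requires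
  both to have the same type.
\<close>

definition indep_rv ::
    "'a measure \<Rightarrow> 'b measure \<Rightarrow> ('a \<Rightarrow> 'b) \<Rightarrow> 'c measure \<Rightarrow> ('a \<Rightarrow> 'c) \<Rightarrow> bool" where
  "indep_rv M MX X MY Y \<longleftrightarrow>
     X \<in> measurable M MX \<and> Y \<in> measurable M MY \<and>
     prob_space.indep_set M
       (sets (vimage_algebra (space M) X MX)) (sets (vimage_algebra (space M) Y MY))"

definition sec_power ::
    "real \<Rightarrow> real \<Rightarrow> (nat \<Rightarrow> 'a \<Rightarrow> real) \<Rightarrow> (nat \<Rightarrow> 'a \<Rightarrow> real) \<Rightarrow> nat \<Rightarrow> 'a \<Rightarrow> real" where
  "sec_power Pm Psi h hp i \<omega> = h i \<omega> * min Pm (Psi / hp i \<omega>)"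

definition cap_I ::
    "real \<Rightarrow> (nat \<Rightarrow> real) \<Rightarrow> real \<Rightarrow> real \<Rightarrow> (nat \<Rightarrow> 'a \<Rightarrow> real) \<Rightarrow> (nat \<Rightarrow> 'a \<Rightarrow> real) \<Rightarrow>
     (nat \<Rightarrow> nat \<Rightarrow> 'a \<Rightarrow> real) \<Rightarrow> nat \<Rightarrow> nat \<Rightarrow> 'a \<Rightarrow> real" where
  "cap_I Pm Pn Psi \<eta> h hp g n i \<omega> =
     ln (1 + sec_power Pm Psi h hp i \<omega> / (Pn n * g n i \<omega> + \<eta>))"

definition cap_NI ::
    "real \<Rightarrow> real \<Rightarrow> real \<Rightarrow> (nat \<Rightarrow> 'a \<Rightarrow> real) \<Rightarrow> (nat \<Rightarrow> 'a \<Rightarrow> real) \<Rightarrow> nat \<Rightarrow> 'a \<Rightarrow> real" where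
  "cap_NI Pm Psi \<eta> h hp i \<omega> = ln (1 + sec_power Pm Psi h hp i \<omega> / \<eta>)"

definition capacity ::
    "nat \<Rightarrow> nat \<Rightarrow> (nat \<Rightarrow> nat set) \<Rightarrow> ('a \<Rightarrow> nat set) \<Rightarrow> real \<Rightarrow> (nat \<Rightarrow> real) \<Rightarrow> real \<Rightarrow> real \<Rightarrow>
     (nat \<Rightarrow> 'a \<Rightarrow> real) \<Rightarrow> (nat \<Rightarrow> 'a \<Rightarrow> real) \<Rightarrow> (nat \<Rightarrow> nat \<Rightarrow> 'a \<Rightarrow> real) \<Rightarrow> 'a \<Rightarrow> real" where
  "capacity N FS A S Pm Pn Psi \<eta> h hp g \<omega> =
     (\<Sum>n=1..N. \<Sum>i=1..collisions A S n \<omega>. cap_I Pm Pn Psi \<eta> h hp g n i \<omega>) +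
     (\<Sum>i=1..free_picked N FS A S \<omega>. cap_NI Pm Psi \<eta> h hp i \<omega>)"

end

theory Submission imports Defs begin

text \<open>
  Write the inner sum up to a random bound as a sum over all subcarriers weighted by
  the indicator of not exceeding the bound. The bound depends only on the random choice and the
  summands only on the channel gains, so every expectation factorises, and as the
  summands have a common mean, Wald's identity results: the mean of the sum is the mean of the
  bound times the common mean. By linearity the mean number of picked subcarriers in a fixed
  set \<open>B\<close> is \<open>card B\<close> times the probability \<open>FS / F\<close> of picking a given subcarrier.
\<close>

section \<open>Counting choices and the mean number of picked subcarriers\<close>

lemma finite_choices: "finite (choices F FS)"
  unfolding choices_def by (rule finite_subset[of _ "Pow {1..F}"]) auto

lemma card_choices: "card (choices F FS) = F choose FS"
  unfolding choices_def by (subst n_subsets) auto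

text \<open>Counting the choices that avoid \<open>b\<close> keeps clear of the lower index
  \<open>FS - 1\<close>, which would truncate at \<open>FS = 0\<close>: they are the
  \<open>FS\<close>-subsets of a set with \<open>F - 1\<close> elements, and
  \<open>binomial_absorb_comp\<close> compares their number with \<open>F choose FS\<close>. The
  factor \<open>F\<close> stands in for a division of natural numbers.\<close>

lemma card_choices_containing:
  assumes "b \<in> {1..F}" "FS \<le> F"
  shows "F * card {T \<in> choices F FS. b \<in> T} = FS * (F choose FS)"
proof -
  have "{T \<in> choices F FS. b \<notin> T} = {T. T \<subseteq> {1..F} - {b} \<and> card T = FS}"
    by (auto simp: choices_def)
  then have "card {T \<in> choices F FS. b \<notin> T} = (F - 1) choose FS"
    using assms by (simp add: n_subsets)
  moreover have "card (choices F FS) =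
      card {T \<in> choices F FS. b \<in> T} + card {T \<in> choices F FS. b \<notin> T}"
    by (subst card_Un_disjoint[symmetric])
      (auto simp: finite_choices intro!: arg_cong[where f = card])
  ultimately have "F * (F choose FS) =
      F * card {T \<in> choices F FS. b \<in> T} + F * ((F - 1) choose FS)"
    by (simp add: card_choices distrib_left)
  moreover have "F * (F choose FS) = (F - FS) * (F choose FS) + FS * (F choose FS)"
    using assms by (simp add: distrib_right[symmetric])
  ultimately show ?thesis
    by (simp add: binomial_absorb_comp)
qed

text \<open>Double counting of the pairs of a choice \<open>T\<close> and a subcarrier
  \<open>b\<close> in \<open>T \<inter> B\<close>.\<close>

lemma sum_card_Int_choices:
  assumes "B \<subseteq> {1..F}" "FS \<le> F"
  shows "F * (\<Sum>T\<in>choices F FS. card (T \<inter> B)) = FS * card B * (F choose FS)"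
proof -
  have fin: "finite B"
    using assms(1) finite_subset by blast
  have "(\<Sum>T\<in>choices F FS. card (T \<inter> B)) = (\<Sum>T\<in>choices F FS. \<Sum>b\<in>B. of_bool (b \<in> T))"
    using fin by (simp add: Int_commute Int_def)
  also have "\<dots> = (\<Sum>b\<in>B. card {T \<in> choices F FS. b \<in> T})"
    by (subst sum.swap) (simp add: finite_choices Int_def)
  finally have "F * (\<Sum>T\<in>choices F FS. card (T \<inter> B)) =
      (\<Sum>b\<in>B. F * card {T \<in> choices F FS. b \<in> T})"
    by (simp add: sum_distrib_left)
  also have "\<dots> = (\<Sum>b\<in>B. FS * (F choose FS))"
    using assms by (intro sum.cong card_choices_containing) auto
  finally show ?thesis
    by simp
qed

lemma uniform_choice_in_choices:
  "uniform_choice M F FS S \<Longrightarrow> \<omega> \<in> space M \<Longrightarrow> S \<omega> \<in> choices F FS"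
  unfolding uniform_choice_def by (auto dest: measurable_space)

text \<open>This is the mean of a hypergeometric variable. Pushing the integral forward along
  \<open>S\<close> turns it into a plain average over all choices, so the hypergeometric weights
  never appear.\<close>

lemma expectation_collisions:
  assumes "uniform_choice M F FS S" "B \<subseteq> {1..F}" "0 < F" "FS \<le> F"
  shows "(\<integral>\<omega>. real (card (S \<omega> \<inter> B)) \<partial>M) = real FS / real F * real (card B)"
proof -
  have "(\<integral>\<omega>. real (card (S \<omega> \<inter> B)) \<partial>M) =
      (\<integral>T. real (card (T \<inter> B)) \<partial>distr M (count_space (choices F FS)) S)"
    using assms(1) by (subst integral_distr) (auto simp: uniform_choice_def)
  also have "\<dots> = real (\<Sum>T\<in>choices F FS. card (T \<inter> B)) / real (F choose FS)"
    using assms(1)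
    by (simp add: uniform_choice_def integral_uniform_count_measure finite_choices card_choices)
  also have "\<dots> = real FS / real F * real (card B)"
  proof -
    have "real F * real (\<Sum>T\<in>choices F FS. card (T \<inter> B)) =
        real FS * real (card B) * real (F choose FS)"
      using sum_card_Int_choices[OF assms(2,4)] by (metis of_nat_mult)
    moreover have "real (F choose FS) > 0"
      using assms(4) by simp
    ultimately show ?thesis
      using assms(3) by (simp add: field_simps del: of_nat_sum)
  qed
  finally show ?thesis .
qed

section \<open>Independence and Wald's identity for a bounded random number of terms\<close>

lemma sigma_sets_vimage_comp_subset:
  assumes "X \<in> measurable M N" "f \<in> measurable N L"
  shows "sigma_sets (space M) {(\<lambda>\<omega>. f (X \<omega>)) -` A \<inter> space M |A. A \<in> sets L}
      \<subseteq> sets (vimage_algebra (space M) X N)"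
proof -
  have X: "X \<in> space M \<rightarrow> space N"
    using assms(1) by (auto dest: measurable_space)
  have "{(\<lambda>\<omega>. f (X \<omega>)) -` A \<inter> space M |A. A \<in> sets L} \<subseteq> sets (vimage_algebra (space M) X N)"
  proof safe
    fix A assume A: "A \<in> sets L"
    have "(\<lambda>\<omega>. f (X \<omega>)) -` A \<inter> space M = X -` (f -` A \<inter> space N) \<inter> space M"
      using X by auto
    moreover have "f -` A \<inter> space N \<in> sets N"
      using assms(2) A by (rule measurable_sets)
    ultimately show "(\<lambda>\<omega>. f (X \<omega>)) -` A \<inter> space M \<in> sets (vimage_algebra (space M) X N)"
      unfolding sets_vimage_algebra2[OF X] by blast
  qed
  then show ?thesis
    using sets.sigma_sets_subset[of _ "vimage_algebra (space M) X N"] by simp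
qed

text \<open>A function of \<open>X\<close> generates a smaller sigma-algebra than \<open>X\<close>
  does, and independence passes to smaller families. This is the passage from
  \<open>indep_rv\<close>, where the value types differ, to \<open>indep_var\<close>, whose product
  rule for expectations is used below.\<close>

lemma (in prob_space) indep_var_comp_indep_rv:
  assumes "indep_rv M MX X MY Y" "u \<in> measurable MX N1" "v \<in> measurable MY N2"
  shows "indep_var N1 (\<lambda>\<omega>. u (X \<omega>)) N2 (\<lambda>\<omega>. v (Y \<omega>))"
proof -
  have X: "X \<in> measurable M MX" and Y: "Y \<in> measurable M MY"
    using assms(1) by (auto simp: indep_rv_def)
  have "indep_set (sets (vimage_algebra (space M) X MX)) (sets (vimage_algebra (space M) Y MY))"
    using assms(1) by (simp add: indep_rv_def)
  then have "indep_set
      (sigma_sets (space M) {(\<lambda>\<omega>. u (X \<omega>)) -` A \<inter> space M |A. A \<in> sets N1})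
      (sigma_sets (space M) {(\<lambda>\<omega>. v (Y \<omega>)) -` A \<inter> space M |A. A \<in> sets N2})"
    unfolding indep_set_def
    by (rule indep_sets_mono_sets)
       (use sigma_sets_vimage_comp_subset[OF X assms(2)] sigma_sets_vimage_comp_subset[OF Y assms(3)]
         in \<open>simp split: bool.splits\<close>)
  then show ?thesis
    unfolding indep_var_eq using X Y assms(2,3) by (simp add: measurable_compose)
qed

text \<open>Makes the range of summation deterministic, so that linearity of expectation applies
  when \<open>k\<close> is random.\<close>

lemma sum_atMost_eq_sum_of_bool:
  fixes x :: "nat \<Rightarrow> real"
  assumes "k \<le> F"
  shows "(\<Sum>i=1..k. x i) = (\<Sum>i=1..F. of_bool (i \<le> k) * x i)"
proof -
  have "(\<Sum>i=1..F. of_bool (i \<le> k) * x i) = (\<Sum>i\<in>{1..F} \<inter> {i. i \<le> k}. x i)"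
    by (simp add: sum.inter_restrict)
  also have "{1..F} \<inter> {i. i \<le> k} = {1..k}"
    using assms by auto
  finally show ?thesis by simp
qed

text \<open>The indicator of \<open>j \<le> k (X \<omega>)\<close> is a function of \<open>X\<close>
  and the summand a function of \<open>Y\<close>, so each product factorises separately; the
  summands may depend on one another. The bound \<open>F\<close> keeps all sums finite, so no limit
  is involved.\<close>

lemma (in prob_space) wald_identity:
  fixes k :: "'b \<Rightarrow> nat" and v :: "nat \<Rightarrow> 'c \<Rightarrow> real"
  assumes indep: "indep_rv M MX X MY Y"
    and k: "k \<in> measurable MX (count_space UNIV)"
    and le: "\<And>\<omega>. \<omega> \<in> space M \<Longrightarrow> k (X \<omega>) \<le> F"
    and v: "\<And>j. j \<in> {1..F} \<Longrightarrow> v j \<in> borel_measurable MY"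
    and int: "\<And>j. j \<in> {1..F} \<Longrightarrow> integrable M (\<lambda>\<omega>. v j (Y \<omega>))"
    and mean: "\<And>j. j \<in> {1..F} \<Longrightarrow> expectation (\<lambda>\<omega>. v j (Y \<omega>)) = c"
  shows "integrable M (\<lambda>\<omega>. \<Sum>j=1..k (X \<omega>). v j (Y \<omega>))" (is ?int)
    and "expectation (\<lambda>\<omega>. \<Sum>j=1..k (X \<omega>). v j (Y \<omega>)) = expectation (\<lambda>\<omega>. real (k (X \<omega>))) * c"
      (is ?eq)
proof -
  let ?u = "\<lambda>j \<omega>. of_bool (j \<le> k (X \<omega>)) :: real"
  have X [measurable]: "X \<in> measurable M MX"
    using indep by (simp add: indep_rv_def)
  note [measurable] = k
  have u_int: "integrable M (?u j)" for j
    by (rule integrable_const_bound[of _ 1]) auto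
  have indep_j: "indep_var borel (?u j) borel (\<lambda>\<omega>. v j (Y \<omega>))" if "j \<in> {1..F}" for j
    by (rule indep_var_comp_indep_rv[OF indep]) (use v[OF that] in measurable)
  have prod_int: "integrable M (\<lambda>\<omega>. ?u j \<omega> * v j (Y \<omega>))" if "j \<in> {1..F}" for j
    by (rule indep_var_integrable[OF indep_j[OF that] u_int int[OF that]])
  have prod_eq: "expectation (\<lambda>\<omega>. ?u j \<omega> * v j (Y \<omega>)) = expectation (?u j) * c"
    if "j \<in> {1..F}" for j
    using indep_var_lebesgue_integral[OF indep_j[OF that] u_int int[OF that]] mean[OF that]
    by simp
  have rewrite: "(\<Sum>j=1..k (X \<omega>). v j (Y \<omega>)) = (\<Sum>j=1..F. ?u j \<omega> * v j (Y \<omega>))"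
    if "\<omega> \<in> space M" for \<omega>
    by (rule sum_atMost_eq_sum_of_bool[OF le[OF that]])
  \<comment> \<open>With every summand equal to 1 the same rewriting returns the bound itself; hence
    the means of the indicators add up to the mean of \<open>k (X \<omega>)\<close>.\<close>
  have count: "real (k (X \<omega>)) = (\<Sum>j=1..F. ?u j \<omega>)" if "\<omega> \<in> space M" for \<omega>
    using sum_atMost_eq_sum_of_bool[OF le[OF that], of "\<lambda>_. 1"] by simp
  have "integrable M (\<lambda>\<omega>. \<Sum>j=1..F. ?u j \<omega> * v j (Y \<omega>))"
    using prod_int by (intro Bochner_Integration.integrable_sum) auto
  then show ?int
    by (subst Bochner_Integration.integrable_cong[OF refl rewrite])
  have "expectation (\<lambda>\<omega>. \<Sum>j=1..k (X \<omega>). v j (Y \<omega>)) =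
      expectation (\<lambda>\<omega>. \<Sum>j=1..F. ?u j \<omega> * v j (Y \<omega>))"
    by (rule Bochner_Integration.integral_cong[OF refl rewrite])
  also have "\<dots> = (\<Sum>j=1..F. expectation (?u j) * c)"
    using prod_int prod_eq by (subst Bochner_Integration.integral_sum) auto
  also have "\<dots> = (\<Sum>j=1..F. expectation (?u j)) * c"
    by (simp only: sum_distrib_right)
  also have "(\<Sum>j=1..F. expectation (?u j)) = expectation (\<lambda>\<omega>. \<Sum>j=1..F. ?u j \<omega>)"
    using u_int by (subst Bochner_Integration.integral_sum) auto
  also have "\<dots> = expectation (\<lambda>\<omega>. real (k (X \<omega>)))"
    by (rule Bochner_Integration.integral_cong[OF refl count[symmetric]])
  finally show ?eq .
qed

text \<open>The set \<open>B\<close> is arbitrary so that it can be the band of a primary user as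
  well as the set of free subcarriers; every term of the capacity is an instance.\<close>

lemma (in prob_space) expectation_sum_collisions:
  fixes v :: "nat \<Rightarrow> 'c \<Rightarrow> real"
  assumes "uniform_choice M F FS S" "B \<subseteq> {1..F}" "0 < F" "FS \<le> F"
    and indep: "indep_rv M (count_space (choices F FS)) S MY Y"
    and v: "\<And>j. j \<in> {1..F} \<Longrightarrow> v j \<in> borel_measurable MY"
    and int: "\<And>j. j \<in> {1..F} \<Longrightarrow> integrable M (\<lambda>\<omega>. v j (Y \<omega>))"
    and mean: "\<And>j. j \<in> {1..F} \<Longrightarrow> expectation (\<lambda>\<omega>. v j (Y \<omega>)) = c"
  shows "integrable M (\<lambda>\<omega>. \<Sum>j=1..card (S \<omega> \<inter> B). v j (Y \<omega>))"
    and "expectation (\<lambda>\<omega>. \<Sum>j=1..card (S \<omega> \<inter> B). v j (Y \<omega>)) =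
      real FS / real F * real (card B) * c"
proof -
  have le: "card (S \<omega> \<inter> B) \<le> F" for \<omega>
    using card_mono[of "{1..F}" "S \<omega> \<inter> B"] assms(2) by auto
  note wald = wald_identity[where k = "\<lambda>T. card (T \<inter> B)", OF indep _ le v int mean]
  show "integrable M (\<lambda>\<omega>. \<Sum>j=1..card (S \<omega> \<inter> B). v j (Y \<omega>))"
    by (rule wald(1)) auto
  have "expectation (\<lambda>\<omega>. \<Sum>j=1..card (S \<omega> \<inter> B). v j (Y \<omega>)) =
      expectation (\<lambda>\<omega>. real (card (S \<omega> \<inter> B))) * c"
    by (rule wald(2)) auto
  then show "expectation (\<lambda>\<omega>. \<Sum>j=1..card (S \<omega> \<inter> B). v j (Y \<omega>)) =
      real FS / real F * real (card B) * c"
    using assms(1-4) by (simp add: expectation_collisions)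
qed

section \<open>Equality of the mean capacities across subcarriers\<close>

lemma (in prob_space) indep_vars_reindex:
  assumes "indep_vars (\<lambda>_. N) X J" "inj_on r I" "r ` I \<subseteq> J"
  shows "indep_vars (\<lambda>_. N) (\<lambda>k. X (r k)) I"
proof -
  \<comment> \<open>Injectivity of \<open>r\<close> makes the singletons \<open>{r k}\<close>
    disjoint blocks of \<open>J\<close>. Grouping a family by disjoint blocks preserves
    independence, and evaluation at \<open>r k\<close> then recovers the single variable.\<close>
  have "indep_vars (\<lambda>k. PiM {r k} (\<lambda>_. N)) (\<lambda>k \<omega>. restrict (\<lambda>i. X i \<omega>) {r k}) I"
    using assms
    by (intro indep_vars_restrict[of _ _ J])
       (auto simp: disjoint_family_on_def inj_on_def)
  then have "indep_vars (\<lambda>_. N) (\<lambda>k \<omega>. (\<lambda>x. x (r k)) (restrict (\<lambda>i. X i \<omega>) {r k})) I"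
    by (rule indep_vars_compose2) simp
  then show ?thesis
    by simp
qed

text \<open>Independence makes the joint law the product of the margins, so equal margins give equal
  joint laws and equal means of any measurable function.\<close>

lemma (in prob_space) expectation_eq_of_indep_same_margins:
  fixes f :: "('i \<Rightarrow> 'b) \<Rightarrow> real"
  assumes X: "indep_vars (\<lambda>_. N) X I" and Y: "indep_vars (\<lambda>_. N) Y I" and "I \<noteq> {}"
    and eq: "\<And>k. k \<in> I \<Longrightarrow> distr M N (X k) = distr M N (Y k)"
    and f [measurable]: "f \<in> borel_measurable (PiM I (\<lambda>_. N))"
  shows "expectation (\<lambda>\<omega>. f (\<lambda>k\<in>I. X k \<omega>)) = expectation (\<lambda>\<omega>. f (\<lambda>k\<in>I. Y k \<omega>))"
proof -
  have joint: "distr M (PiM I (\<lambda>_. N)) (\<lambda>\<omega>. \<lambda>k\<in>I. Z k \<omega>) = PiM I (\<lambda>k. distr M N (Z k))"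
      and meas: "(\<lambda>\<omega>. \<lambda>k\<in>I. Z k \<omega>) \<in> measurable M (PiM I (\<lambda>_. N))"
    if "indep_vars (\<lambda>_. N) Z I" for Z :: "'i \<Rightarrow> 'a \<Rightarrow> 'b"
  proof -
    have rv: "\<And>k. k \<in> I \<Longrightarrow> random_variable N (Z k)"
      using that by (auto simp: indep_vars_def)
    show "distr M (PiM I (\<lambda>_. N)) (\<lambda>\<omega>. \<lambda>k\<in>I. Z k \<omega>) = PiM I (\<lambda>k. distr M N (Z k))"
      using indep_vars_iff_distr_eq_PiM'[OF \<open>I \<noteq> {}\<close> rv] that by simp
    show "(\<lambda>\<omega>. \<lambda>k\<in>I. Z k \<omega>) \<in> measurable M (PiM I (\<lambda>_. N))"
      using rv by measurable
  qed
  have "distr M (PiM I (\<lambda>_. N)) (\<lambda>\<omega>. \<lambda>k\<in>I. X k \<omega>) =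
      distr M (PiM I (\<lambda>_. N)) (\<lambda>\<omega>. \<lambda>k\<in>I. Y k \<omega>)"
    unfolding joint[OF X] joint[OF Y] using eq by (intro PiM_cong) auto
  then show ?thesis
    using integral_distr[OF meas[OF X] f] integral_distr[OF meas[OF Y] f] by simp
qed

lemma mem_gain_indices:
  "SecLink j \<in> gain_indices N F \<longleftrightarrow> j \<in> {1..F}"
  "SecToPrim j \<in> gain_indices N F \<longleftrightarrow> j \<in> {1..F}"
  "PrimToSec n j \<in> gain_indices N F \<longleftrightarrow> n \<in> {1..N} \<and> j \<in> {1..F}"
  by (auto simp: gain_indices_def image_iff)

text \<open>The capacity as a deterministic function of the gains: in this form its measurability
  can be stated on the product space, and the independence of \<open>S\<close> from the gain vector
  carries over to it.\<close>

definition cap_of_gains ::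
    "real \<Rightarrow> (nat \<Rightarrow> real) \<Rightarrow> real \<Rightarrow> real \<Rightarrow> nat \<Rightarrow> nat \<Rightarrow> (gain_index \<Rightarrow> real) \<Rightarrow> real" where
  "cap_of_gains Pm Pn Psi \<eta> n j x =
     ln (1 + x (SecLink j) * min Pm (Psi / x (SecToPrim j)) / (Pn n * x (PrimToSec n j) + \<eta>))"

lemma cap_I_eq_cap_of_gains:
  assumes "n \<in> {1..N}" "j \<in> {1..F}"
  shows "cap_I Pm Pn Psi \<eta> h hp g n j \<omega> = cap_of_gains Pm Pn Psi \<eta> n j (gain_vector N F h hp g \<omega>)"
  using assms by (simp add: cap_I_def sec_power_def cap_of_gains_def gain_vector_def mem_gain_indices)

text \<open>\<open>I\<close> is general because two product spaces occur: over all gain indices, and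
  over the three indices of one subcarrier.\<close>

lemma cap_of_gains_measurable:
  assumes "SecLink j \<in> I" "SecToPrim j \<in> I" "PrimToSec n j \<in> I"
  shows "cap_of_gains Pm Pn Psi \<eta> n j \<in> borel_measurable (PiM I (\<lambda>_. borel))"
proof -
  have [measurable]: "(\<lambda>x. x k) \<in> borel_measurable (PiM I (\<lambda>_. borel :: real measure))" if "k \<in> I" for k
    using that by measurable
  note [measurable] = this[OF assms(1)] this[OF assms(2)] this[OF assms(3)]
  show ?thesis
    unfolding cap_of_gains_def[abs_def] by measurable
qed

text \<open>A primary user of zero power causes no interference. Free subcarriers thus become a case
  of occupied ones.\<close>

lemma cap_NI_eq_cap_I: "cap_NI Pm Psi \<eta> h hp j = cap_I Pm (\<lambda>_. 0) Psi \<eta> h hp g n j"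
  by (simp add: fun_eq_iff cap_NI_def cap_I_def)

lemma (in prob_space) expectation_cap_I_eq:
  assumes indep: "indep_vars (\<lambda>_. borel) (gain h hp g) (gain_indices N F)"
    and h: "distr M borel (h j) = distr M borel (h i)"
    and hp: "distr M borel (hp j) = distr M borel (hp i)"
    and g: "distr M borel (g n j) = distr M borel (g n i)"
    and n: "n \<in> {1..N}" and j: "j \<in> {1..F}" and i: "i \<in> {1..F}"
  shows "expectation (cap_I Pm Pn Psi \<eta> h hp g n j) = expectation (cap_I Pm Pn Psi \<eta> h hp g n i)"
proof -
  define I where "I = {SecLink i, SecToPrim i, PrimToSec n i}"
  \<comment> \<open>\<open>r\<close> sends each gain of subcarrier \<open>i\<close> to the gain of
    the same kind on subcarrier \<open>j\<close>. It is injective on \<open>I\<close>, which has one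
    index of each kind. Evaluating the capacity function of \<open>i\<close> at the relabelled gains
    yields the capacity on \<open>j\<close>.\<close>
  define r where "r = case_gain_index (\<lambda>_. SecLink j) (\<lambda>_. SecToPrim j) (\<lambda>_ _. PrimToSec n j)"
  have "indep_vars (\<lambda>_. borel) (\<lambda>k. gain h hp g (r k)) I"
    by (rule indep_vars_reindex[OF indep])
       (use n j in \<open>auto simp: I_def r_def mem_gain_indices inj_on_def\<close>)
  moreover have "indep_vars (\<lambda>_. borel) (gain h hp g) I"
    by (rule indep_vars_subset[OF indep]) (use n i in \<open>auto simp: I_def mem_gain_indices\<close>)
  ultimately have "expectation (\<lambda>\<omega>. cap_of_gains Pm Pn Psi \<eta> n i (\<lambda>k\<in>I. gain h hp g (r k) \<omega>)) =
      expectation (\<lambda>\<omega>. cap_of_gains Pm Pn Psi \<eta> n i (\<lambda>k\<in>I. gain h hp g k \<omega>))"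
    by (rule expectation_eq_of_indep_same_margins)
       (use h hp g in \<open>auto simp: I_def r_def intro!: cap_of_gains_measurable\<close>)
  then show ?thesis
    by (simp add: cap_I_def[abs_def] sec_power_def cap_of_gains_def I_def r_def)
qed

section \<open>Free subcarriers and assembly of the expected capacity\<close>

lemma free_picked_eq_card:
  assumes "S \<omega> \<in> choices F FS" and A: "disjoint_family_on A {1..N}"
  shows "free_picked N FS A S \<omega> = card (S \<omega> \<inter> ({1..F} - (\<Union>n\<in>{1..N}. A n)))"
proof -
  have S: "S \<omega> \<subseteq> {1..F}" "card (S \<omega>) = FS" "finite (S \<omega>)"
    using assms(1) by (auto simp: choices_def intro: finite_subset)
  \<comment> \<open>By disjointness the collisions count a subset of \<open>S \<omega>\<close>, so
    the subtraction in \<open>free_picked\<close> is exact and leaves the size of a difference of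
    sets.\<close>
  have "(\<Sum>n=1..N. collisions A S n \<omega>) = card (\<Union>n\<in>{1..N}. S \<omega> \<inter> A n)"
    unfolding collisions_def
    using S(3) A by (subst card_UN_disjoint) (auto simp: disjoint_family_on_def)
  moreover have "card (S \<omega> - (\<Union>n\<in>{1..N}. S \<omega> \<inter> A n)) =
      card (S \<omega>) - card (\<Union>n\<in>{1..N}. S \<omega> \<inter> A n)"
    using S(3) by (intro card_Diff_subset) (auto intro: finite_subset)
  moreover have "S \<omega> - (\<Union>n\<in>{1..N}. S \<omega> \<inter> A n) = S \<omega> \<inter> ({1..F} - (\<Union>n\<in>{1..N}. A n))"
    using S(1) by auto
  ultimately show ?thesis
    unfolding free_picked_def S(2)[symmetric] by simp
qed

theorem corollary1:
  fixes M :: "'a measure"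
    and N F FS :: nat
    and FP :: "nat \<Rightarrow> nat"
    and A :: "nat \<Rightarrow> nat set"
    and S :: "'a \<Rightarrow> nat set"
    and Pm Psi \<eta> :: real
    and Pn :: "nat \<Rightarrow> real"
    and h hp :: "nat \<Rightarrow> 'a \<Rightarrow> real"
    and g :: "nat \<Rightarrow> nat \<Rightarrow> 'a \<Rightarrow> real"
    and i :: nat
  assumes "prob_space M"
    and "N \<ge> 1" "F > 0" "FS > 0" "FS \<le> F"
    and "\<And>n. n \<in> {1..N} \<Longrightarrow> FP n > 0"
    and "(\<Sum>n=1..N. FP n) \<le> F"
    and "\<And>n. n \<in> {1..N} \<Longrightarrow> A n \<subseteq> {1..F}"
    and "\<And>n. n \<in> {1..N} \<Longrightarrow> card (A n) = FP n"
    and "disjoint_family_on A {1..N}"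
    and "Pm > 0" "Psi > 0" "\<eta> > 0"
    and "\<And>n. n \<in> {1..N} \<Longrightarrow> Pn n > 0"
    and "uniform_choice M F FS S"
    and "\<And>j. j \<in> gain_indices N F \<Longrightarrow> AE \<omega> in M. gain h hp g j \<omega> > 0"
    and "prob_space.indep_vars M (\<lambda>_. borel) (gain h hp g) (gain_indices N F)"
    and "\<And>j k. j \<in> {1..F} \<Longrightarrow> k \<in> {1..F} \<Longrightarrow> distr M borel (h j) = distr M borel (h k)"
    and "\<And>j k. j \<in> {1..F} \<Longrightarrow> k \<in> {1..F} \<Longrightarrow> distr M borel (hp j) = distr M borel (hp k)"
    and "\<And>n j k. n \<in> {1..N} \<Longrightarrow> j \<in> {1..F} \<Longrightarrow> k \<in> {1..F} \<Longrightarrow>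
           distr M borel (g n j) = distr M borel (g n k)"
    and "indep_rv M (count_space (choices F FS)) S
           (PiM (gain_indices N F) (\<lambda>_. borel)) (gain_vector N F h hp g)"
    and "\<And>n j. n \<in> {1..N} \<Longrightarrow> j \<in> {1..F} \<Longrightarrow> integrable M (cap_I Pm Pn Psi \<eta> h hp g n j)"
    and "\<And>j. j \<in> {1..F} \<Longrightarrow> integrable M (cap_NI Pm Psi \<eta> h hp j)"
    and "i \<in> {1..F}"
  shows "prob_space.expectation M (capacity N FS A S Pm Pn Psi \<eta> h hp g) =
    real FS / real F *
      ((\<Sum>n=1..N. real (FP n) * prob_space.expectation M (cap_I Pm Pn Psi \<eta> h hp g n i)) +
       real (F - (\<Sum>n=1..N. FP n)) * prob_space.expectation M (cap_NI Pm Psi \<eta> h hp i))"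
proof -
  interpret prob_space M by fact
  note n_range = \<open>N \<ge> 1\<close> and A = assms(8-10) and unif = assms(15) and indep = assms(17)
    and ident = assms(18-20) and indep_S = assms(21) and int_I = assms(22) and int_NI = assms(23)
    and i = \<open>i \<in> {1..F}\<close>
  let ?I = "cap_I Pm Pn Psi \<eta> h hp g" and ?NI = "cap_NI Pm Psi \<eta> h hp"
  let ?B = "{1..F} - (\<Union>n\<in>{1..N}. A n)"
  \<comment> \<open>The power \<open>P\<close> is kept variable: \<open>Pn\<close> gives the primary
    users' terms, the zero function the free term.\<close>
  have gains: "integrable M (\<lambda>\<omega>. \<Sum>j=1..card (S \<omega> \<inter> B). cap_I Pm P Psi \<eta> h hp g n j \<omega>)"
      "expectation (\<lambda>\<omega>. \<Sum>j=1..card (S \<omega> \<inter> B). cap_I Pm P Psi \<eta> h hp g n j \<omega>) =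
        real FS / real F * real (card B) * expectation (cap_I Pm P Psi \<eta> h hp g n i)"
    if B: "B \<subseteq> {1..F}" and n: "n \<in> {1..N}"
      and int: "\<And>j. j \<in> {1..F} \<Longrightarrow> integrable M (cap_I Pm P Psi \<eta> h hp g n j)" for B P n
  proof -
    let ?v = "cap_of_gains Pm P Psi \<eta> n" and ?Y = "gain_vector N F h hp g"
    have v: "?v j \<in> borel_measurable (PiM (gain_indices N F) (\<lambda>_. borel))" if "j \<in> {1..F}" for j
      using n that by (intro cap_of_gains_measurable) (auto simp: mem_gain_indices)
    have eq: "cap_I Pm P Psi \<eta> h hp g n j = (\<lambda>\<omega>. ?v j (?Y \<omega>))" if "j \<in> {1..F}" for j
      by (rule ext) (rule cap_I_eq_cap_of_gains[OF n that])
    have vint: "integrable M (\<lambda>\<omega>. ?v j (?Y \<omega>))" if "j \<in> {1..F}" for j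
      using int[OF that] eq[OF that] by simp
    have mean: "expectation (\<lambda>\<omega>. ?v j (?Y \<omega>)) = expectation (cap_I Pm P Psi \<eta> h hp g n i)"
      if "j \<in> {1..F}" for j
      unfolding eq[OF that, symmetric]
      by (rule expectation_cap_I_eq[OF indep ident(1)[OF that i] ident(2)[OF that i]
            ident(3)[OF n that i] n that i])
    note * = expectation_sum_collisions[where v = ?v, OF unif B \<open>F > 0\<close> \<open>FS \<le> F\<close> indep_S v vint mean]
    have sum_eq: "(\<Sum>j=1..card (S \<omega> \<inter> B). cap_I Pm P Psi \<eta> h hp g n j \<omega>) =
        (\<Sum>j=1..card (S \<omega> \<inter> B). ?v j (?Y \<omega>))" for \<omega>
    \<comment> \<open>\<open>gain_vector\<close> is \<open>undefined\<close> outside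
      \<open>gain_indices N F\<close>, so the two summands are compared only for \<open>j\<close> up
      to \<open>F\<close>.\<close>
    proof (rule sum.cong[OF refl])
      fix j assume "j \<in> {1..card (S \<omega> \<inter> B)}"
      moreover have "card (S \<omega> \<inter> B) \<le> F"
        using card_mono[of "{1..F}" "S \<omega> \<inter> B"] B by auto
      ultimately have "j \<in> {1..F}"
        by simp
      then show "cap_I Pm P Psi \<eta> h hp g n j \<omega> = ?v j (?Y \<omega>)"
        by (rule cap_I_eq_cap_of_gains[OF n])
    qed
    show "integrable M (\<lambda>\<omega>. \<Sum>j=1..card (S \<omega> \<inter> B). cap_I Pm P Psi \<eta> h hp g n j \<omega>)"
      unfolding sum_eq by (rule *(1))
    show "expectation (\<lambda>\<omega>. \<Sum>j=1..card (S \<omega> \<inter> B). cap_I Pm P Psi \<eta> h hp g n j \<omega>) =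
        real FS / real F * real (card B) * expectation (cap_I Pm P Psi \<eta> h hp g n i)"
      unfolding sum_eq by (rule *(2))
  qed
  have PU: "integrable M (\<lambda>\<omega>. \<Sum>j=1..collisions A S n \<omega>. ?I n j \<omega>)"
      "expectation (\<lambda>\<omega>. \<Sum>j=1..collisions A S n \<omega>. ?I n j \<omega>) =
        real FS / real F * real (FP n) * expectation (?I n i)" if n: "n \<in> {1..N}" for n
    using gains[OF A(1)[OF n] n int_I[OF n]] A(2)[OF n] by (simp_all add: collisions_def)
  \<comment> \<open>At zero power any primary user will do as the nominal interferer; user 1 exists
    because \<open>N \<ge> 1\<close>.\<close>
  note NI_eq = cap_NI_eq_cap_I[of Pm Psi \<eta> h hp _ g 1]
  have free: "integrable M (\<lambda>\<omega>. \<Sum>j=1..card (S \<omega> \<inter> ?B). ?NI j \<omega>)"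
      "expectation (\<lambda>\<omega>. \<Sum>j=1..card (S \<omega> \<inter> ?B). ?NI j \<omega>) =
        real FS / real F * real (card ?B) * expectation (?NI i)"
  proof -
    have B: "?B \<subseteq> {1..F}" and n: "1 \<in> {1..N}"
      using n_range by auto
    have "integrable M (cap_I Pm (\<lambda>_. 0) Psi \<eta> h hp g 1 j)" if "j \<in> {1..F}" for j
      using int_NI[OF that] by (simp only: NI_eq)
    note * = gains[OF B n this]
    show "integrable M (\<lambda>\<omega>. \<Sum>j=1..card (S \<omega> \<inter> ?B). ?NI j \<omega>)"
      unfolding NI_eq by (rule *(1))
    show "expectation (\<lambda>\<omega>. \<Sum>j=1..card (S \<omega> \<inter> ?B). ?NI j \<omega>) =
        real FS / real F * real (card ?B) * expectation (?NI i)"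
      unfolding NI_eq by (rule *(2))
  qed
  have fin: "finite (A n)" if "n \<in> {1..N}" for n
    using A(1)[OF that] finite_subset by blast
  have "card (\<Union>n\<in>{1..N}. A n) = (\<Sum>n=1..N. card (A n))"
    using A(3) fin by (intro card_UN_disjoint) (simp_all add: disjoint_family_on_def)
  moreover have "(\<Union>n\<in>{1..N}. A n) \<subseteq> {1..F}"
    using A(1) by (rule UN_least)
  ultimately have "card ?B = F - (\<Sum>n=1..N. FP n)"
    using A(2) fin by (subst card_Diff_subset) simp_all
  note free = free[unfolded this]
  have "expectation (capacity N FS A S Pm Pn Psi \<eta> h hp g) =
      expectation (\<lambda>\<omega>. (\<Sum>n=1..N. \<Sum>j=1..collisions A S n \<omega>. ?I n j \<omega>) +
        (\<Sum>j=1..card (S \<omega> \<inter> ?B). ?NI j \<omega>))"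
    using free_picked_eq_card[where S = S, OF uniform_choice_in_choices[OF unif] A(3)]
    by (intro Bochner_Integration.integral_cong) (auto simp: capacity_def)
  \<comment> \<open>The collision counts of different users may be dependent; linearity asks only
    that each term be integrable.\<close>
  also have "\<dots> = (\<Sum>n=1..N. expectation (\<lambda>\<omega>. \<Sum>j=1..collisions A S n \<omega>. ?I n j \<omega>)) +
      expectation (\<lambda>\<omega>. \<Sum>j=1..card (S \<omega> \<inter> ?B). ?NI j \<omega>)"
    using PU(1) free(1) by (subst Bochner_Integration.integral_add) auto
  also have "\<dots> = (\<Sum>n=1..N. real FS / real F * real (FP n) * expectation (?I n i)) +
      real FS / real F * real (F - (\<Sum>n=1..N. FP n)) * expectation (?NI i)"
    using PU(2) free(2) by simp
  finally show ?thesis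
    by (simp only: distrib_left sum_distrib_left mult.assoc)
qed

end
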